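(* Let $t\neq 0$. For every integer $n\ge 0$, $$1+ \sum_{k=1}^n \frac{(-1)^k}{t^k} \left(L_{k+2} +(t-1)L_{k}\right) = \frac{(-1)^n}{t^n}L_{n+1},$$ where $L_k$ are the Lucas numbers.
   Context: The Lucas numbers $L_k$ ($k\ge 0$) satisfy $L_{n+2}=L_{n+1}+L_n$ for $n\ge 0$, with $L_0=2$, $L_1=1$. Here $t$ is an indeterminate, which may be specialized to any nonzero complex number. Empty sums equal $0$. *)

theory Defs
  imports Complex_Main
begin

fun lucas :: "nat \<Rightarrow> nat" where
  "lucas 0 = 2"
| "lucas (Suc 0) = 1"
| "lucas (Suc (Suc n)) = lucas (Suc n) + lucas n"

end

theory Submission
  imports Defs
begin

text \<open>The sum telescopes. With a_k = (-1)^k L_{k+1} / t^k, the recurrence L_{k+2} - L_k =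
  L_{k+1} turns the k-th summand into (-1)^k (L_{k+1} + t L_k) / t^k = a_k - a_{k-1}, and the
  leading 1 is a_0 = L_1.\<close>

theorem mainTheorem7:
  fixes t :: "'a::field_char_0" and n :: nat
  assumes "t \<noteq> 0"
  shows "1 + (\<Sum>k=1..n. (-1) ^ k / t ^ k * (of_nat (lucas (k + 2)) + (t - 1) * of_nat (lucas k)))
    = (-1) ^ n / t ^ n * of_nat (lucas (n + 1))"
proof (induction n)
  case 0
  then show ?case by simp
next
  case (Suc n)
  let ?L = "\<lambda>k. of_nat (lucas k) :: 'a"
  have "1 + (\<Sum>k=1..Suc n. (-1) ^ k / t ^ k * (?L (k + 2) + (t - 1) * ?L k))
      = (-1) ^ n / t ^ n * ?L (n + 1)
        + (-1) ^ Suc n / t ^ Suc n * (?L (Suc n + 2) + (t - 1) * ?L (Suc n))"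
    using Suc.IH by (simp add: add.assoc [symmetric] del: lucas.simps power_Suc)
  \<comment> \<open>Over the denominator \<open>t ^ Suc n\<close>, the old right-hand side cancels
    the part \<open>t * ?L (Suc n)\<close> of the new summand. Lucas values stay atomic, so this is
    pure field algebra.\<close>
  also have "\<dots> = (-1) ^ Suc n / t ^ Suc n * (?L (Suc n + 2) - ?L (Suc n))"
    using assms by (simp add: field_simps del: lucas.simps)
  also have "?L (Suc n + 2) - ?L (Suc n) = ?L (Suc n + 1)"
    by simp
  finally show ?case .
qed

end
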